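(* Let $U\subseteq\mathbb{R}^n$ be open and let $F:U\to\mathbb{R}^n$ be a continuous injective map that preserves many denominators. Then $F$ preserves the Lebesgue measure.
   Context: Every $u\in\mathbb{Q}^n$ can be written uniquely as $u=(a_1/k,\ldots,a_n/k)$ with $a_1,\ldots,a_n,k$ integers, $k\ge1$, and $\gcd(a_1,\ldots,a_n,k)=1$; then $k$ is the denominator of $u$, written $k=\mathrm{den}(u)$ (equivalently, the l.c.m. of the reduced denominators of the coordinates). A map $F:U\to\mathbb{R}^n$ ($U\subseteq\mathbb{R}^n$ open) preserves many denominators if for infinitely many integers $k\ge1$, $F$ induces a bijection between $\{u\in U\cap\mathbb{Q}^n:\mathrm{den}(u)=k\}$ and $\{v\in F[U]\cap\mathbb{Q}^n:\mathrm{den}(v)=k\}$. $F$ preserves the Lebesgue measure $\lambda$ if both $F$ and $F^{-1}$ send $\lambda$-measurable sets to $\lambda$-measurable sets, with preservation of the measure. *)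

theory Defs
  imports "HOL-Analysis.Analysis"
begin

definition rational_points :: "(real ^ 'n) set" where
  "rational_points = {u. \<forall>i. u $ i \<in> \<rat>}"

definition reduced_form :: "real ^ 'n \<Rightarrow> ('n \<Rightarrow> int) \<Rightarrow> nat \<Rightarrow> bool" where
  "reduced_form u a k \<longleftrightarrow>
     k \<ge> 1 \<and> (\<forall>i. u $ i = real_of_int (a i) / real k) \<and> Gcd (insert (int k) (range a)) = 1"

text \<open>Meaningful only on rational points; see \<open>reduced_form_unique\<close>, \<open>den_eqI\<close> below.\<close>

definition den :: "real ^ 'n \<Rightarrow> nat" where
  "den u = (THE k. \<exists>a. reduced_form u a k)"

definition preserves_many_denominators ::
  "(real ^ 'n) set \<Rightarrow> (real ^ 'n \<Rightarrow> real ^ 'n) \<Rightarrow> bool" where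
  "preserves_many_denominators U F \<longleftrightarrow>
     infinite {k. k \<ge> 1 \<and>
       bij_betw F {u \<in> U \<inter> rational_points. den u = k}
                  {v \<in> F ` U \<inter> rational_points. den v = k}}"

definition images_preserve_lebesgue ::
  "(real ^ 'n) set \<Rightarrow> (real ^ 'n \<Rightarrow> real ^ 'n) \<Rightarrow> bool" where
  "images_preserve_lebesgue S G \<longleftrightarrow>
     (\<forall>A \<subseteq> S. A \<in> sets lebesgue \<longrightarrow>
        G ` A \<in> sets lebesgue \<and> emeasure lebesgue (G ` A) = emeasure lebesgue A)"

text \<open>For \<open>F\<close> injective on \<open>U\<close>, \<open>inv_into U F\<close> restricted to \<open>F ` U\<close> is the inverse
  map \<open>F ` U \<rightarrow> U\<close>.\<close>

definition preserves_lebesgue_measure ::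
  "(real ^ 'n) set \<Rightarrow> (real ^ 'n \<Rightarrow> real ^ 'n) \<Rightarrow> bool" where
  "preserves_lebesgue_measure U F \<longleftrightarrow>
     images_preserve_lebesgue U F \<and> images_preserve_lebesgue (F ` U) (inv_into U F)"

lemma reduced_form_dvd:
  assumes "reduced_form u a k" "reduced_form u b l"
  shows "k dvd l"
proof -
  have *: "a i * int l = b i * int k" for i
  proof -
    have "real_of_int (a i) / real k = real_of_int (b i) / real l" "k \<ge> 1" "l \<ge> 1"
      using assms unfolding reduced_form_def by metis+
    then have "real_of_int (a i * int l) = real_of_int (b i * int k)"
      by (simp add: field_simps)
    then show ?thesis by linarith
  qed
  have "int k dvd Gcd ((*) (int l) ` insert (int k) (range a))"
  proof (rule Gcd_greatest)
    fix x assume "x \<in> (*) (int l) ` insert (int k) (range a)"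
    then show "int k dvd x"
      using * by (auto simp: mult.commute[of "int l"])
  qed
  also have "Gcd ((*) (int l) ` insert (int k) (range a)) = int l"
    using assms(1) unfolding reduced_form_def by (subst Gcd_mult) simp
  finally show ?thesis by simp
qed

lemma reduced_form_unique:
  assumes "reduced_form u a k" "reduced_form u b l"
  shows "k = l" and "a = b"
proof -
  show "k = l" using reduced_form_dvd[OF assms] reduced_form_dvd[OF assms(2,1)] by (rule dvd_antisym)
  then show "a = b" using assms by (auto simp: reduced_form_def fun_eq_iff)
qed

lemma den_eqI: "reduced_form u a k \<Longrightarrow> den u = k"
  unfolding den_def by (rule the_equality) (auto dest: reduced_form_unique(1))

lemma reduced_form_exists:
  fixes u :: "real ^ 'n"
  assumes "u \<in> rational_points"
  shows "\<exists>a k. reduced_form u a k"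
proof -
  have "\<exists>p::int \<times> int. snd p > 0 \<and> u $ i = of_int (fst p) / of_int (snd p)" for i
  proof -
    have "u $ i \<in> \<rat>" using assms by (simp add: rational_points_def)
    then obtain c d where "d > 0" "u $ i = of_int c / of_int d" by (rule Rats_cases')
    then show ?thesis by (intro exI[of _ "(c, d)"]) simp
  qed
  then obtain p where p: "snd (p i) > 0"
      "u $ i = of_int (fst (p i)) / of_int (snd (p i :: int \<times> int))" for i
    by metis
  define K where "K = (\<Prod>i\<in>UNIV. snd (p i))"
  have K: "K > 0" unfolding K_def using p(1) by (simp add: prod_pos)
  define b where "b i = fst (p i) * (K div snd (p i))" for i
  have b: "u $ i = of_int (b i) / of_int K" for i
  proof -
    have "snd (p i) dvd K" unfolding K_def by (rule dvd_prodI) auto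
    then obtain c where c: "K = snd (p i) * c" ..
    with K have "c \<noteq> 0" by auto
    then show ?thesis using p(1)[of i] p(2)[of i] by (simp add: b_def c)
  qed
  define g where "g = Gcd (insert K (range b))"
  have gK: "g dvd K" and gb: "g dvd b i" for i
    unfolding g_def by (rule Gcd_dvd; simp)+
  have "g \<noteq> 0" using gK K by auto
  moreover have "g \<ge> 0" unfolding g_def by simp
  ultimately have g0: "g > 0" by simp
  have Kg: "K div g > 0" using gK K g0 by (simp add: pos_imp_zdiv_pos_iff zdvd_imp_le)
  have "(*) g ` insert (K div g) (range (\<lambda>i. b i div g)) = insert K (range b)"
    using gK gb by (simp add: image_image)
  then have "g = normalize (g * Gcd (insert (K div g) (range (\<lambda>i. b i div g))))"
    unfolding Gcd_mult[symmetric] by (simp only: g_def)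
  also have "\<dots> = g * Gcd (insert (K div g) (range (\<lambda>i. b i div g)))"
    using g0 by (simp add: normalize_mult)
  finally have "g * Gcd (insert (K div g) (range (\<lambda>i. b i div g))) = g" by (rule sym)
  then have G: "Gcd (insert (K div g) (range (\<lambda>i. b i div g))) = 1" using g0 by simp
  have "u $ i = of_int (b i div g) / of_int (K div g)" for i
    using b[of i] gK gb[of i] g0 by (simp add: real_of_int_div)
  then have "reduced_form u (\<lambda>i. b i div g) (nat (K div g))"
    using Kg G unfolding reduced_form_def by auto
  then show ?thesis by blast
qed

end

theory Submission
  imports Defs
begin

text \<open>
  The points with denominator \<open>k\<close> are equidistributed: a Legendre sieve over the primes dividing \<open>k\<close>
  shows that a box of volume \<open>V\<close> contains \<open>V J(k) + O(2^\<omega>(k) k^(n - 1))\<close> of them, where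
  \<open>J(k) = k^n \<Prod>(1 - p^-n)\<close> is Jordan's totient and \<open>\<omega>(k)\<close> the number of primes dividing \<open>k\<close>, and
  the error is \<open>o(J(k))\<close>. If finitely many disjoint boxes lie in the image of a box \<open>B \<subseteq> U\<close>, then for
  infinitely many \<open>k\<close> they contain together at most as many such points as \<open>B\<close>, so their total
  volume is at most that of \<open>B\<close>. Hence \<open>F\<close> does not increase the measure of boxes, and by covering
  arguments that of any measurable set. By invariance of domain the inverse of \<open>F\<close> satisfies the
  same hypotheses, which gives equality.
\<close>

section \<open>Sieving lattice points in boxes\<close>

lemma int_open_interval_eq: "{z::int. a < of_int z \<and> of_int z < (b::real)} = {\<lfloor>a\<rfloor> + 1..\<lceil>b\<rceil> - 1}"
proof -
  have "a < of_int z \<longleftrightarrow> \<lfloor>a\<rfloor> + 1 \<le> z" for z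
    by (simp add: add1_zle_eq floor_less_iff)
  moreover have "of_int z < b \<longleftrightarrow> z \<le> \<lceil>b\<rceil> - 1" for z
    by (simp add: zle_diff1_eq less_ceiling_iff)
  ultimately show ?thesis by auto
qed

lemma card_int_open_interval:
  fixes a b :: real
  assumes "a \<le> b"
  shows "\<bar>real (card {z::int. a < of_int z \<and> of_int z < b}) - (b - a)\<bar> \<le> 1"
  \<comment> \<open>The count is \<lceil>b\<rceil> - \<lfloor>a\<rfloor> - 1, cut off at 0; the
    cut-off acts only when a = b is an integer.\<close>
  unfolding int_open_interval_eq using assms by simp linarith

text \<open>After division by \<open>M\<close> all factors lie in [0, 1], where replacing factors
  one at a time changes the product by at most the sum of the changes.\<close>

lemma abs_prod_diff_le:
  fixes x y :: "'i \<Rightarrow> real" and M :: real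
  assumes M: "M > 0" and x: "\<And>i. i \<in> I \<Longrightarrow> 0 \<le> x i \<and> x i \<le> M"
    and y: "\<And>i. i \<in> I \<Longrightarrow> 0 \<le> y i \<and> y i \<le> M" and d: "\<And>i. i \<in> I \<Longrightarrow> \<bar>x i - y i\<bar> \<le> 1"
  shows "\<bar>prod x I - prod y I\<bar> \<le> card I * M ^ (card I - 1)"
\<comment> \<open>In the remaining cases both products are 1 and \<open>card I\<close> is 0.\<close>
proof (cases "finite I \<and> I \<noteq> {}")
  case True
  then have c: "card I > 0" by (simp add: card_gt_0_iff)
  have "\<bar>(\<Prod>i\<in>I. x i / M) - (\<Prod>i\<in>I. y i / M)\<bar> \<le> (\<Sum>i\<in>I. \<bar>x i / M - y i / M\<bar>)"
    using norm_prod_diff[of I "\<lambda>i. x i / M" "\<lambda>i. y i / M"] x y M by simp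
  also have "\<dots> \<le> (\<Sum>i\<in>I. 1 / M)"
    using d M by (intro sum_mono) (simp add: diff_divide_distrib[symmetric] divide_right_mono)
  finally have "\<bar>prod x I - prod y I\<bar> / M ^ card I \<le> card I / M"
    using M by (simp add: prod_dividef diff_divide_distrib[symmetric])
  then have "\<bar>prod x I - prod y I\<bar> \<le> card I / M * M ^ card I"
    using M by (simp add: pos_divide_le_eq)
  also have "\<dots> = card I * M ^ (card I - 1)"
    using M c by (cases "card I") auto
  finally show ?thesis .
qed auto

text \<open>With \<open>S\<close> the primes dividing k these are the numerator vectors of reduced
  fractions with denominator k; a free \<open>S\<close> and real bounds permit induction over the
  primes.\<close>

definition sifted_box :: "nat set \<Rightarrow> ('n \<Rightarrow> real) \<Rightarrow> ('n \<Rightarrow> real) \<Rightarrow> ('n \<Rightarrow> int) set" where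
  "sifted_box S l u = {x. (\<forall>i. l i < of_int (x i) \<and> of_int (x i) < u i) \<and> (\<forall>p\<in>S. \<exists>i. \<not> int p dvd x i)}"

lemma sifted_box_empty:
  fixes l u :: "'n::finite \<Rightarrow> real"
  shows "sifted_box {} l u = PiE UNIV (\<lambda>i. {z. l i < of_int z \<and> of_int z < u i})"
  by (auto simp: sifted_box_def PiE_def Pi_def)

lemma finite_sifted_box: "finite (sifted_box S l (u :: 'n::finite \<Rightarrow> real))"
proof (rule finite_subset)
  show "sifted_box S l u \<subseteq> sifted_box {} l u" by (auto simp: sifted_box_def)
  show "finite (sifted_box {} l u)"
    unfolding sifted_box_empty int_open_interval_eq by (intro finite_PiE) auto
qed

text \<open>Legendre's sieve step: the vectors struck out by \<open>p\<close> are the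
  \<open>p\<close>-fold multiples of those in the box shrunk by \<open>p\<close>, and multiplying by
  \<open>p\<close> leaves divisibility by the other primes unchanged.\<close>

lemma sifted_box_insert:
  assumes "prime p" "\<And>q. q \<in> S \<Longrightarrow> prime q" "p \<notin> S"
  shows "sifted_box (insert p S) l u
    = sifted_box S l u - (\<lambda>x i. int p * x i) ` sifted_box S (\<lambda>i. l i / p) (\<lambda>i. u i / p)"
    and "(\<lambda>x i. int p * x i) ` sifted_box S (\<lambda>i. l i / p) (\<lambda>i. u i / p) \<subseteq> sifted_box S l u"
proof -
  have p: "p > 0" using assms(1) prime_gt_0_nat by blast
  have "int q dvd int p * z \<longleftrightarrow> int q dvd z" if "q \<in> S" for q z
  proof -
    have "coprime q p" using assms that by (intro primes_coprime) auto
    then have "coprime (int q) (int p)" by simp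
    then show ?thesis by (rule coprime_dvd_mult_right_iff)
  qed
  then have *: "(\<lambda>i. int p * x i) \<in> sifted_box S l u
      \<longleftrightarrow> x \<in> sifted_box S (\<lambda>i. l i / p) (\<lambda>i. u i / p)" for x
    using p by (simp add: sifted_box_def pos_divide_less_eq pos_less_divide_eq mult.commute[of "real p"])
  then show "(\<lambda>x i. int p * x i) ` sifted_box S (\<lambda>i. l i / p) (\<lambda>i. u i / p) \<subseteq> sifted_box S l u"
    by auto
  have "x \<in> (\<lambda>x i. int p * x i) ` sifted_box S (\<lambda>i. l i / p) (\<lambda>i. u i / p)"
    if x: "x \<in> sifted_box S l u" "\<forall>i. int p dvd x i" for x
  proof -
    obtain y where "x = (\<lambda>i. int p * y i)" using x(2) unfolding dvd_def fun_eq_iff by metis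
    then show ?thesis using x(1) * by auto
  qed
  moreover have "sifted_box (insert p S) l u = {x \<in> sifted_box S l u. \<exists>i. \<not> int p dvd x i}"
    by (auto simp: sifted_box_def)
  ultimately show "sifted_box (insert p S) l u
    = sifted_box S l u - (\<lambda>x i. int p * x i) ` sifted_box S (\<lambda>i. l i / p) (\<lambda>i. u i / p)"
    by auto
qed

text \<open>By \<open>sifted_box_insert\<close> each new prime subtracts the count for a shrunken
  box: the main term gains the factor 1 - p^-n and the error bound doubles. The 1 in
  \<open>M + 1\<close> absorbs the rounding of the count in one coordinate.\<close>

lemma card_sifted_box:
  fixes l u :: "'n::finite \<Rightarrow> real" and M :: real
  assumes "finite S" "\<And>p. p \<in> S \<Longrightarrow> prime p" "\<And>i. l i \<le> u i" "\<And>i. u i - l i \<le> M"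
  shows "\<bar>card (sifted_box S l u) - (\<Prod>i\<in>UNIV. u i - l i) * (\<Prod>p\<in>S. 1 - 1 / real p ^ CARD('n))\<bar>
    \<le> 2 ^ card S * (CARD('n) * (M + 1) ^ (CARD('n) - 1))"
  using assms
proof (induction S arbitrary: l u rule: finite_induct)
  case empty
  let ?c = "\<lambda>i. card {z::int. l i < of_int z \<and> of_int z < u i}"
  have c: "\<bar>real (?c i) - (u i - l i)\<bar> \<le> 1" for i
    using empty(2) by (intro card_int_open_interval)
  have M: "M \<ge> 0" using empty(2,3)[of undefined] by linarith
  have "\<bar>(\<Prod>i\<in>UNIV. real (?c i)) - (\<Prod>i\<in>UNIV. u i - l i)\<bar> \<le> CARD('n) * (M + 1) ^ (CARD('n) - 1)"
  proof (intro abs_prod_diff_le)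
    show "0 \<le> real (?c i) \<and> real (?c i) \<le> M + 1" "0 \<le> u i - l i \<and> u i - l i \<le> M + 1" for i
      using c[of i] empty(2,3)[of i] by auto
  qed (use M c in auto)
  then show ?case by (simp add: sifted_box_empty card_PiE)
next
  case (insert p S)
  have p: "p > 0" using insert.prems(1)[of p] prime_gt_0_nat by blast
  let ?n = "CARD('n)" and ?D = "\<Prod>p\<in>S. 1 - 1 / real p ^ CARD('n)" and ?V = "\<Prod>i\<in>UNIV. u i - l i"
  let ?E = "2 ^ card S * (CARD('n) * (M + 1) ^ (CARD('n) - 1))"
  let ?A = "sifted_box S l u" and ?B = "sifted_box S (\<lambda>i. l i / p) (\<lambda>i. u i / p)"
  have 1: "\<bar>card ?A - ?V * ?D\<bar> \<le> ?E" using insert by simp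
  \<comment> \<open>Shrinking does not increase side lengths, so the same \<open>M\<close> serves
    for the smaller box.\<close>
  have "\<bar>card ?B - (\<Prod>i\<in>UNIV. u i / p - l i / p) * ?D\<bar> \<le> ?E"
  proof (intro insert.IH)
    fix i
    have "u i / p - l i / p \<le> u i - l i"
      using insert.prems(2)[of i] p unfolding diff_divide_distrib[symmetric]
      by (simp add: divide_le_eq mult_le_cancel_left1)
    then show "u i / p - l i / p \<le> M" using insert.prems(3)[of i] by linarith
    show "l i / p \<le> u i / p" using insert.prems(2)[of i] by (simp add: divide_right_mono)
  qed (use insert in auto)
  then have 2: "\<bar>card ?B - ?V / real p ^ ?n * ?D\<bar> \<le> ?E"
    by (simp add: diff_divide_distrib[symmetric] prod_dividef)
  have inj: "inj_on (\<lambda>x i. int p * x i) ?B"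
    using p by (intro inj_onI) (auto simp: fun_eq_iff)
  have "card (sifted_box (insert p S) l u) = real (card ?A) - card ?B"
    using sifted_box_insert[of p S l u] insert.prems(1) insert.hyps
    by (simp add: card_Diff_subset finite_sifted_box card_image[OF inj] card_mono of_nat_diff
        flip: card_image[OF inj])
  moreover have "?V * (\<Prod>p\<in>insert p S. 1 - 1 / real p ^ ?n) = ?V * ?D - ?V / real p ^ ?n * ?D"
    using insert.hyps by (simp add: algebra_simps)
  moreover have "2 ^ card (insert p S) * (?n * (M + 1) ^ (?n - 1)) = ?E + ?E"
    using insert.hyps by simp
  ultimately show ?case using 1 2 by linarith
qed

text \<open>Each \<open>p \<in> S\<close> contributes \<open>4p / (p - 1)^2\<close> to the ratio of the two sides; this exceeds \<open>1\<close> only for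
  \<open>p = 2, 3, 5\<close>, and \<open>30 = 8 * 3 * 5/4\<close> is the product of these three values.\<close>

lemma four_pow_card_primes_le:
  assumes "finite S" "\<And>p. p \<in> S \<Longrightarrow> prime p"
  shows "4 ^ card S \<le> 30 * real (\<Prod>S) * (\<Prod>p\<in>S. 1 - 1 / real p)\<^sup>2"
proof -
  define f :: "nat \<Rightarrow> real" where "f p = 4 * p / (p - 1)\<^sup>2" for p
  have f0: "f p \<ge> 0" for p by (simp add: f_def)
  have gt: "real p > 1" if "p \<in> S" for p using assms(2)[OF that] prime_gt_1_nat by simp
  have small: "f p \<le> 1" if "p \<in> S - {2,3,5}" for p
  proof -
    have "prime p" using that assms by auto
    then have "p \<ge> 6"
    proof (rule contrapos_pp)
      assume "\<not> p \<ge> 6"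
      then have "p = 0 \<or> p = 1 \<or> p = 4" using that by auto
      moreover have "\<not> prime (4::nat)" unfolding prime_nat_iff by (auto intro!: exI[of _ 2])
      ultimately show "\<not> prime p" by auto
    qed
    then have "real p * 6 \<le> real p * real p" by (intro mult_left_mono) auto
    then have "4 * real p \<le> (real p - 1)\<^sup>2" by (simp add: power2_eq_square algebra_simps)
    then show ?thesis by (simp add: f_def divide_le_eq_1)
  qed
  have "prod f S = prod f (S - {2,3,5}) * prod f (S \<inter> {2,3,5})"
    using assms(1) by (subst prod.Int_Diff[of _ _ "{2,3,5}"]) auto
  also have "\<dots> \<le> 1 * prod f (S \<inter> {2,3,5})"
    using small f0 by (intro mult_right_mono prod_le_1 prod_nonneg) auto
  \<comment> \<open>The values of \<open>f\<close> at 2, 3 and 5 are all at least 1, so adding the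
    missing primes does not decrease the product.\<close>
  also have "\<dots> \<le> 1 * prod f {2,3,5}"
    using f0 by (intro mult_left_mono prod_mono2) (auto simp: f_def)
  also have "\<dots> = 30" by (simp add: f_def)
  finally have f30: "prod f S \<le> 30" .
  have "4 ^ card S = (\<Prod>p\<in>S. f p * (real p * (1 - 1 / real p)\<^sup>2))"
  proof -
    have "f p * (real p * (1 - 1 / real p)\<^sup>2) = 4" if "p \<in> S" for p
    proof -
      have "1 - 1 / real p = (real p - 1) / real p" using gt[OF that] by (simp add: field_simps)
      then show ?thesis using gt[OF that] by (simp add: f_def power2_eq_square)
    qed
    then show ?thesis by simp
  qed
  also have "\<dots> = prod f S * (real (\<Prod>S) * (\<Prod>p\<in>S. 1 - 1 / real p)\<^sup>2)"
    by (simp add: prod.distrib prod_power_distrib)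
  also have "\<dots> \<le> 30 * (real (\<Prod>S) * (\<Prod>p\<in>S. 1 - 1 / real p)\<^sup>2)"
    using f30 by (intro mult_right_mono mult_nonneg_nonneg) (auto intro: prod_nonneg)
  finally show ?thesis by (simp add: mult_ac)
qed

section \<open>Equidistribution of points with a given denominator\<close>

text \<open>Turns the coprimality condition of \<open>reduced_form\<close> into the sieving
  condition of \<open>sifted_box\<close>: a gcd other than 1 has a prime divisor, which then divides
  \<open>k\<close>.\<close>

lemma Gcd_insert_eq_1_iff:
  assumes "k > 0"
  shows "Gcd (insert (int k) (range x)) = 1 \<longleftrightarrow> (\<forall>p\<in>prime_factors k. \<exists>i. \<not> int p dvd x i)"
proof
  assume G: "Gcd (insert (int k) (range x)) = 1"
  show "\<forall>p\<in>prime_factors k. \<exists>i. \<not> int p dvd x i"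
  proof (rule ballI, rule ccontr)
    fix p assume p: "p \<in> prime_factors k" and "\<not> (\<exists>i. \<not> int p dvd x i)"
    then have "int p dvd Gcd (insert (int k) (range x))"
      by (intro Gcd_greatest) auto
    then have "int p dvd 1" unfolding G .
    then show False using p by (auto simp: in_prime_factors_iff)
  qed
next
  assume *: "\<forall>p\<in>prime_factors k. \<exists>i. \<not> int p dvd x i"
  let ?g = "Gcd (insert (int k) (range x))"
  have gk: "?g dvd int k" and gx: "?g dvd x i" for i by (rule Gcd_dvd; simp)+
  show "?g = 1"
  proof (rule ccontr)
    assume "?g \<noteq> 1"
    then have "nat ?g \<noteq> 1" by linarith
    then obtain p where p: "prime p" "p dvd nat ?g" using prime_factor_nat by blast
    then have "int p dvd ?g" by (metis Gcd_int_greater_eq_0 int_dvd_int_iff nat_0_le)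
    then have "int p dvd int k" "\<And>i. int p dvd x i" using gk gx dvd_trans by blast+
    moreover from this have "p \<in> prime_factors k" using p(1) assms by (simp add: in_prime_factors_iff)
    ultimately show False using * by blast
  qed
qed

text \<open>Membership in \<open>rational_points\<close> is imposed because \<open>den\<close> is an
  unspecified value elsewhere.\<close>

definition den_points :: "nat \<Rightarrow> (real ^ 'n) set" where
  "den_points k = {u \<in> rational_points. den u = k}"

lemma den_points_eq: "den_points k = {u. \<exists>x. reduced_form u x k}"
proof -
  have "u \<in> rational_points" if "reduced_form u x k" for u :: "real ^ 'n" and x
    using that by (simp add: reduced_form_def rational_points_def)
  moreover have "\<exists>x. reduced_form u x (den u)" if "u \<in> rational_points" for u :: "real ^ 'n"
    using reduced_form_exists[OF that] den_eqI by blast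
  ultimately show ?thesis by (auto simp: den_points_def dest: den_eqI)
qed

lemma box_den_points:
  fixes a b :: "real ^ 'n"
  assumes "k \<ge> 1"
  shows "box a b \<inter> den_points k = (\<lambda>x. \<chi> i. of_int (x i) / real k) `
    sifted_box (prime_factors k) (\<lambda>i. k * a $ i) (\<lambda>i. k * b $ i)"
proof -
  have k: "real k > 0" using assms by simp
  have *: "x \<in> sifted_box (prime_factors k) (\<lambda>i. k * a $ i) (\<lambda>i. k * b $ i)
      \<longleftrightarrow> u \<in> box a b \<and> reduced_form u x k" if "u = (\<chi> i. of_int (x i) / real k)" for x u
    using assms k unfolding that
    by (simp add: reduced_form_def sifted_box_def mem_box_cart Gcd_insert_eq_1_iff del: Gcd_insert
        add: pos_less_divide_eq pos_divide_less_eq mult.commute[of "real k"])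
  show ?thesis
  proof (intro set_eqI iffI)
    fix u assume "u \<in> box a b \<inter> den_points k"
    then obtain x where x: "u \<in> box a b" "reduced_form u x k" by (auto simp: den_points_eq)
    moreover have "u = (\<chi> i. of_int (x i) / real k)" using x by (simp add: reduced_form_def vec_eq_iff)
    ultimately show "u \<in> (\<lambda>x. \<chi> i. of_int (x i) / real k) `
        sifted_box (prime_factors k) (\<lambda>i. k * a $ i) (\<lambda>i. k * b $ i)"
      using * by blast
  qed (use * in \<open>auto simp: den_points_eq\<close>)
qed

lemma card_box_den_points:
  fixes a b :: "real ^ 'n"
  assumes "k \<ge> 1"
  shows "finite (box a b \<inter> den_points k)"
    and "card (box a b \<inter> den_points k) =
      card (sifted_box (prime_factors k) (\<lambda>i. k * a $ i) (\<lambda>i. k * b $ i))"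
proof -
  show "finite (box a b \<inter> den_points k)"
    unfolding box_den_points[OF assms] by (intro finite_imageI finite_sifted_box)
  have "inj (\<lambda>x. (\<chi> i. of_int (x i) / real k) :: real ^ 'n)"
    using assms by (intro injI) (simp add: vec_eq_iff fun_eq_iff)
  then show "card (box a b \<inter> den_points k) =
      card (sifted_box (prime_factors k) (\<lambda>i. k * a $ i) (\<lambda>i. k * b $ i))"
    unfolding box_den_points[OF assms] by (intro card_image) (auto intro: inj_on_subset)
qed

text \<open>The number of points with denominator \<open>k\<close> in a half-open unit cube (Jordan's totient).\<close>

definition den_density :: "nat \<Rightarrow> nat \<Rightarrow> real" where
  "den_density n k = real k ^ n * (\<Prod>p\<in>prime_factors k. 1 - 1 / real p ^ n)"

text \<open>Compares exponent \<open>n\<close> with exponent 1, so that the estimate of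
  \<open>four_pow_card_primes_le\<close> serves in every dimension.\<close>

lemma prime_power_factor_bounds:
  assumes "p \<in> prime_factors k" "n > 0"
  shows "0 < 1 - 1 / real p" "1 - 1 / real p \<le> 1 - 1 / real p ^ n"
proof -
  have p: "real p > 1" using assms(1) prime_gt_1_nat by (simp add: in_prime_factors_iff)
  then show "0 < 1 - 1 / real p" by (simp add: field_simps)
  have "real p ^ 1 \<le> real p ^ n" using p assms(2) by (intro power_increasing) auto
  then show "1 - 1 / real p \<le> 1 - 1 / real p ^ n" using p by (simp add: frac_le)
qed

lemma den_density_pos:
  assumes "k \<ge> 1" "n > 0"
  shows "den_density n k > 0"
proof -
  have "(\<Prod>p\<in>prime_factors k. 1 - 1 / real p ^ n) > 0"
    using prime_power_factor_bounds[OF _ assms(2)] by (intro prod_pos) fastforce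
  then show ?thesis using assms by (simp add: den_density_def)
qed

lemma prod_prime_factors_le: "k \<ge> 1 \<Longrightarrow> \<Prod>(prime_factors k) \<le> (k::nat)"
proof -
  assume k: "k \<ge> 1"
  have "\<Prod>(prime_factors k) = (\<Prod>p\<in>prime_factors k. p ^ 1)" by simp
  also have "\<dots> \<le> (\<Prod>p\<in>prime_factors k. p ^ multiplicity p k)"
    by (intro prod_mono conjI power_increasing)
       (auto simp: in_prime_factors_iff prime_gt_0_nat Suc_le_eq intro: multiplicity_gt_zero_iff[THEN iffD2])
  also have "\<dots> = k" using k prod_prime_factors[of k] by simp
  finally show ?thesis .
qed

text \<open>Controls the sieve error, by the square root of \<open>four_pow_card_primes_le\<close>.
  The product stays on the right in order to cancel against the one in
  \<open>den_density\<close>.\<close>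

lemma two_pow_card_prime_factors_le:
  assumes "k \<ge> 1" "n > 0"
  shows "2 ^ card (prime_factors k) \<le> sqrt (30 * real k) * (\<Prod>p\<in>prime_factors k. 1 - 1 / real p ^ n)"
proof -
  let ?P = "\<Prod>p\<in>prime_factors k. 1 - 1 / real p"
  have P: "0 \<le> ?P" "?P \<le> (\<Prod>p\<in>prime_factors k. 1 - 1 / real p ^ n)"
    using prime_power_factor_bounds[OF _ assms(2)] by (intro prod_nonneg prod_mono; force)+
  have "(2 ^ card (prime_factors k))\<^sup>2 = (4::real) ^ card (prime_factors k)"
    by (simp add: power2_eq_square flip: power_mult_distrib)
  also have "\<dots> \<le> 30 * real (\<Prod>(prime_factors k)) * ?P\<^sup>2"
    by (intro four_pow_card_primes_le) (auto simp: in_prime_factors_iff)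
  also have "\<dots> \<le> 30 * real k * ?P\<^sup>2"
    using prod_prime_factors_le[OF assms(1)] by (intro mult_right_mono mult_left_mono) (auto simp flip: of_nat_prod)
  also have "\<dots> = (sqrt (30 * real k) * ?P)\<^sup>2"
    by (simp add: power_mult_distrib)
  finally have "2 ^ card (prime_factors k) \<le> sqrt (30 * real k) * ?P"
    using P by (auto intro: power2_le_imp_le)
  also have "\<dots> \<le> sqrt (30 * real k) * (\<Prod>p\<in>prime_factors k. 1 - 1 / real p ^ n)"
    using P by (intro mult_left_mono) auto
  finally show ?thesis .
qed

text \<open>This is \<open>card_sifted_box\<close> for the box scaled by \<open>k\<close>, whose
  sides are at most \<open>k * norm (b - a)\<close>; dividing the error by
  \<open>den_density\<close> leaves order 1 / sqrt k.\<close>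

lemma card_box_den_points_asymp:
  fixes a b :: "real ^ 'n"
  assumes "k \<ge> 1" "box a b \<noteq> {}"
  shows "\<bar>card (box a b \<inter> den_points k) / den_density CARD('n) k - measure lborel (box a b)\<bar>
    \<le> sqrt 30 * CARD('n) * (norm (b - a) + 1) ^ (CARD('n) - 1) / sqrt k"
proof -
  let ?n = "CARD('n)" and ?M = "norm (b - a)" and ?V = "measure lborel (box a b)"
  let ?D = "\<Prod>p\<in>prime_factors k. 1 - 1 / real p ^ CARD('n)"
  have ab: "a $ i < b $ i" for i using assms(2) by (simp add: interval_ne_empty_cart)
  have k: "real k > 0" using assms by simp
  have V: "(\<Prod>i\<in>UNIV. k * b $ i - k * a $ i) = real k ^ ?n * ?V"
  proof -
    have "?V = (\<Prod>i\<in>UNIV. b $ i - a $ i)"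
      using content_cbox_cart[of a b] ab interval_ne_empty_cart(1)[of a b]
      by (auto simp: measure_lborel_box_eq measure_lborel_cbox_eq less_imp_le)
    then show ?thesis by (simp add: prod.distrib flip: right_diff_distrib)
  qed
  have "\<bar>card (sifted_box (prime_factors k) (\<lambda>i. k * a $ i) (\<lambda>i. k * b $ i))
     - (\<Prod>i\<in>UNIV. k * b $ i - k * a $ i) * ?D\<bar> \<le> 2 ^ card (prime_factors k) * (?n * (k * ?M + 1) ^ (?n - 1))"
  proof (intro card_sifted_box)
    show "k * a $ i \<le> k * b $ i" for i using ab[of i] by (simp add: mult_left_mono)
    show "k * b $ i - k * a $ i \<le> k * ?M" for i
      using component_le_norm_cart[of "b - a" i] k by (simp flip: right_diff_distrib)
  qed (auto simp: in_prime_factors_iff)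
  then have "\<bar>card (box a b \<inter> den_points k) - ?V * den_density ?n k\<bar>
      \<le> 2 ^ card (prime_factors k) * (?n * (k * ?M + 1) ^ (?n - 1))"
    unfolding card_box_den_points(2)[OF assms(1)] V den_density_def by (simp add: mult_ac)
  \<comment> \<open>Enlarging the summand 1 to \<open>k\<close> lets the power of \<open>k\<close>
    be pulled out.\<close>
  also have "\<dots> \<le> (sqrt (30 * real k) * ?D) * (?n * (k * (?M + 1)) ^ (?n - 1))"
  proof (intro mult_mono mult_left_mono power_mono)
    show "2 ^ card (prime_factors k) \<le> sqrt (30 * real k) * ?D"
      using two_pow_card_prime_factors_le[of k ?n] assms(1) by simp
    then show "0 \<le> sqrt (30 * real k) * ?D"
      by (rule order_trans[rotated]) simp
    show "k * ?M + 1 \<le> k * (?M + 1)" using assms(1) by (simp add: distrib_left)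
  qed simp_all
  also have "\<dots> = (sqrt 30 * ?n * (?M + 1) ^ (?n - 1) / sqrt k) * den_density ?n k"
  proof -
    have "k ^ ?n = real k * real k ^ (?n - 1)" by (simp flip: power_Suc)
    \<comment> \<open>Writing sqrt k as k / sqrt k completes k^(n - 1) to the k^n of
      \<open>den_density\<close>.\<close>
    moreover have "sqrt (30 * real k) = sqrt 30 * (real k / sqrt k)"
      by (simp add: real_sqrt_mult real_div_sqrt)
    ultimately show ?thesis by (simp add: den_density_def power_mult_distrib mult_ac)
  qed
  finally have "\<bar>card (box a b \<inter> den_points k) - ?V * den_density ?n k\<bar> / den_density ?n k
      \<le> sqrt 30 * ?n * (?M + 1) ^ (?n - 1) / sqrt k"
    using den_density_pos[of k ?n] assms(1) by (simp add: pos_divide_le_eq)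
  moreover have "card (box a b \<inter> den_points k) / den_density ?n k - ?V
      = (card (box a b \<inter> den_points k) - ?V * den_density ?n k) / den_density ?n k"
    using den_density_pos[of k ?n] assms(1) by (simp add: diff_divide_distrib)
  ultimately show ?thesis using den_density_pos[of k ?n] assms(1) by simp
qed

text \<open>The normalising factor is the same for every box, so counts in different boxes can be
  compared in the limit.\<close>

lemma tendsto_card_box_den_points:
  fixes a b :: "real ^ 'n"
  shows "(\<lambda>k. card (box a b \<inter> den_points k) / den_density CARD('n) k) \<longlonglongrightarrow> measure lborel (box a b)"
proof (cases "box a b = {}")
  case False
  let ?C = "sqrt 30 * CARD('n) * (norm (b - a) + 1) ^ (CARD('n) - 1)"
  have "(\<lambda>k. ?C / sqrt (real k)) \<longlonglongrightarrow> 0"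
    by (intro tendsto_divide_0[OF tendsto_const] filterlim_at_top_imp_at_infinity
        filterlim_compose[OF sqrt_at_top filterlim_real_sequentially])
  moreover have "\<forall>\<^sub>F k in sequentially. norm (card (box a b \<inter> den_points k) / den_density CARD('n) k
      - measure lborel (box a b)) \<le> ?C / sqrt k"
    using card_box_den_points_asymp[OF _ False] by (intro eventually_sequentiallyI[of 1]) simp
  ultimately have "(\<lambda>k. card (box a b \<inter> den_points k) / den_density CARD('n) k - measure lborel (box a b)) \<longlonglongrightarrow> 0"
    by (rule Lim_null_comparison[rotated])
  then show ?thesis by (rule LIM_zero_cancel)
qed simp

section \<open>Measure preservation\<close>

text \<open>The gauge in \<open>covering_lemma\<close> is chosen so that every cell, being
  controlled by a point of \<open>S\<close>, lies in \<open>W\<close>. The closed boxes cover, the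
  open ones are disjoint, and corresponding ones have the same volume.\<close>

lemma bounded_cover_disjoint_boxes:
  fixes S W :: "'a::euclidean_space set"
  assumes "bounded S" "open W" "S \<subseteq> W"
  obtains c d :: "nat \<Rightarrow> 'a" where "disjoint_family (\<lambda>n. box (c n) (d n))"
    "S \<subseteq> (\<Union>n. cbox (c n) (d n))" "(\<Union>n. cbox (c n) (d n)) \<subseteq> W"
proof -
  \<comment> \<open>Inserting 0 keeps the enclosing box nonempty when \<open>S\<close> is
    empty.\<close>
  have "bounded (insert 0 S)" using assms(1) by simp
  then obtain a where "insert 0 S \<subseteq> box (-a) a" using bounded_subset_box_symmetric by blast
  then have a: "S \<subseteq> cbox (-a) a" "box (-a) a \<noteq> {}" using box_subset_cbox by blast+
  let ?g = "\<lambda>x. if x \<in> W then W else UNIV"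
  have "gauge ?g" using assms(2) by (simp add: gauge_def)
  from covering_lemma[OF a this] obtain \<D> where D: "countable \<D>"
      "\<And>K. K \<in> \<D> \<Longrightarrow> interior K \<noteq> {} \<and> (\<exists>c d. K = cbox c d)"
      "pairwise (\<lambda>A B. interior A \<inter> interior B = {}) \<D>"
      "\<And>K. K \<in> \<D> \<Longrightarrow> \<exists>x\<in>S \<inter> K. K \<subseteq> ?g x" "S \<subseteq> \<Union>\<D>"
    by metis
  obtain l r where lr: "\<And>K. K \<in> \<D> \<Longrightarrow> K = cbox (l K) (r K)" using D(2) by metis
  define N where "N = to_nat_on \<D> ` \<D>"
  define k where "k = from_nat_into \<D>"
  have kD: "k n \<in> \<D>" if "n \<in> N" for n
    using that D(1) by (auto simp: N_def k_def)
  have k_inj: "k m \<noteq> k n" if "m \<in> N" "n \<in> N" "m \<noteq> n" for m n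
    using that D(1) by (auto simp: N_def k_def)
  \<comment> \<open>Indices outside \<open>N\<close> get an empty box, since \<open>One\<close>
    exceeds 0 in every coordinate; this turns a finite or countable family into a sequence.\<close>
  define c d where "c n = (if n \<in> N then l (k n) else One)" and "d n = (if n \<in> N then r (k n) else 0)" for n
  have out: "box (c n) (d n) = {}" "cbox (c n) (d n) = {}" if "n \<notin> N" for n
    using that nonempty_Basis by (auto simp: c_def d_def box_eq_empty ex_in_conv)
  have inN: "cbox (c n) (d n) = k n" if "n \<in> N" for n
    using that lr[OF kD[OF that]] by (simp add: c_def d_def)
  show ?thesis
  proof (rule that)
    show "disjoint_family (\<lambda>n. box (c n) (d n))"
    proof (unfold disjoint_family_on_def, intro ballI impI)
      fix m n :: nat assume "m \<noteq> n"
      show "box (c m) (d m) \<inter> box (c n) (d n) = {}"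
      proof (cases "m \<in> N \<and> n \<in> N")
        case True
        then have "interior (k m) \<inter> interior (k n) = {}"
          using D(3) kD k_inj \<open>m \<noteq> n\<close> by (auto simp: pairwise_def)
        then show ?thesis using True inN by (simp flip: interior_cbox)
      qed (use out in auto)
    qed
    show "S \<subseteq> (\<Union>n. cbox (c n) (d n))"
    proof
      fix x assume "x \<in> S"
      then obtain K where K: "K \<in> \<D>" "x \<in> K" using D(5) by blast
      then have "to_nat_on \<D> K \<in> N" "k (to_nat_on \<D> K) = K" using D(1) by (auto simp: N_def k_def)
      then show "x \<in> (\<Union>n. cbox (c n) (d n))" using inN K(2) by blast
    qed
    have "cbox (c n) (d n) \<subseteq> W" for n
    proof (cases "n \<in> N")
      case True
      then obtain x where "x \<in> S" "k n \<subseteq> ?g x" using D(4) kD by blast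
      moreover from this have "x \<in> W" using assms(3) by blast
      ultimately show ?thesis using True inN by simp
    qed (use out in auto)
    then show "(\<Union>n. cbox (c n) (d n)) \<subseteq> W" by blast
  qed
qed

lemma emeasure_lebesgue_cbox_eq_box: "emeasure lebesgue (cbox a b) = emeasure lebesgue (box a b)"
  by (simp add: emeasure_lborel_box_eq emeasure_lborel_cbox_eq)

lemma emeasure_lebesgue_box: "emeasure lebesgue (box a b) = ennreal (measure lborel (box a b))"
  by (simp add: emeasure_lborel_box_eq measure_lborel_box_eq)

text \<open>The hypotheses form a locale so that everything proved for \<open>F\<close> can be
  applied to its inverse, which is another instance.\<close>

locale many_denominators =
  fixes U :: "(real ^ 'n) set" and F :: "real ^ 'n \<Rightarrow> real ^ 'n"
  assumes open_U: "open U" and cont_F: "continuous_on U F" and inj_F: "inj_on F U"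
    and preserves: "preserves_many_denominators U F"
begin

definition good :: "nat set" where
  "good = {k. k \<ge> 1 \<and> bij_betw F (U \<inter> den_points k) (F ` U \<inter> den_points k)}"

lemma infinite_good: "infinite good"
proof -
  have "{u \<in> X \<inter> rational_points. den u = k} = X \<inter> den_points k" for X :: "(real ^ 'n) set" and k
    by (auto simp: den_points_def)
  then show ?thesis using preserves by (simp add: preserves_many_denominators_def good_def)
qed

lemma open_image:
  assumes "open S" "S \<subseteq> U"
  shows "open (F ` S)"
  using assms cont_F inj_F by (intro invariance_of_domain) (auto intro: continuous_on_subset inj_on_subset)

text \<open>For good \<open>k\<close>, the points of denominator \<open>k\<close> in the disjoint
  boxes are images of distinct such points of \<open>box a b\<close>; counts divided by
  \<open>den_density\<close> become volumes in the limit.\<close>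

lemma sum_measure_boxes_le:
  fixes c d :: "nat \<Rightarrow> real ^ 'n"
  assumes "box a b \<subseteq> U" "disjoint_family (\<lambda>n. box (c n) (d n))" "\<And>n. box (c n) (d n) \<subseteq> F ` box a b"
  shows "(\<Sum>n<N. measure lborel (box (c n) (d n))) \<le> measure lborel (box a b)"
proof -
  let ?w = "den_density CARD('n)"
  let ?f = "\<lambda>k. card (box a b \<inter> den_points k) / ?w k
    - (\<Sum>n<N. card (box (c n) (d n) \<inter> den_points k) / ?w k)"
  have pos: "?f k \<ge> 0" if "k \<in> good" for k
  proof -
    have k: "k \<ge> 1" "bij_betw F (U \<inter> den_points k) (F ` U \<inter> den_points k)"
      using that by (auto simp: good_def)
    have "F ` box a b \<inter> den_points k \<subseteq> F ` (box a b \<inter> den_points k)"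
    proof
      fix v assume v: "v \<in> F ` box a b \<inter> den_points k"
      then obtain x where x: "x \<in> box a b" "v = F x" by blast
      \<comment> \<open>Surjectivity at \<open>k\<close> supplies a preimage of denominator
        \<open>k\<close>, which injectivity of \<open>F\<close> on \<open>U\<close> identifies with
        \<open>x\<close>.\<close>
      have "v \<in> F ` (U \<inter> den_points k)" using k(2) v assms(1) by (auto simp: bij_betw_def)
      then obtain u where "u \<in> U \<inter> den_points k" "v = F u" by blast
      then show "v \<in> F ` (box a b \<inter> den_points k)"
        using x assms(1) inj_F by (auto simp: inj_on_def)
    qed
    then have sub: "(\<Union>n<N. box (c n) (d n) \<inter> den_points k) \<subseteq> F ` (box a b \<inter> den_points k)"
      using assms(3) by blast
    have "(\<Sum>n<N. card (box (c n) (d n) \<inter> den_points k)) = card (\<Union>n<N. box (c n) (d n) \<inter> den_points k)"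
      using assms(2) card_box_den_points(1)[OF k(1)]
      by (intro card_UN_disjoint[symmetric]) (auto simp: disjoint_family_on_def)
    also have "\<dots> \<le> card (F ` (box a b \<inter> den_points k))"
      using card_box_den_points(1)[OF k(1)] sub by (intro card_mono) auto
    also have "\<dots> \<le> card (box a b \<inter> den_points k)"
      using card_box_den_points(1)[OF k(1)] by (rule card_image_le)
    finally have "real (\<Sum>n<N. card (box (c n) (d n) \<inter> den_points k)) \<le> card (box a b \<inter> den_points k)"
      by (rule of_nat_mono)
    then have "real (\<Sum>n<N. card (box (c n) (d n) \<inter> den_points k)) / ?w k \<le> card (box a b \<inter> den_points k) / ?w k"
      using den_density_pos[OF k(1), of "CARD('n)"] by (intro divide_right_mono) auto
    then show ?thesis by (simp add: sum_divide_distrib)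
  qed
  have lim: "?f \<longlonglongrightarrow> measure lborel (box a b) - (\<Sum>n<N. measure lborel (box (c n) (d n)))"
    by (intro tendsto_diff tendsto_sum tendsto_card_box_den_points)
  show ?thesis
  proof (rule ccontr)
    \<comment> \<open>The limit runs over all \<open>k\<close>, so a negative value would make
      \<open>?f\<close> negative for all large \<open>k\<close>, good ones among them.\<close>
    assume "\<not> ?thesis"
    then have "\<forall>\<^sub>F k in sequentially. ?f k < 0"
      by (intro order_tendstoD(2)[OF lim]) simp
    then obtain K where "\<And>k. k \<ge> K \<Longrightarrow> ?f k < 0" unfolding eventually_sequentially by blast
    moreover obtain k where "k \<ge> K" "k \<in> good"
      using infinite_good unfolding infinite_nat_iff_unbounded_le by blast
    ultimately show False using pos by fastforce
  qed
qed

text \<open>Boxes covering \<open>K\<close> within the open image reduce this to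
  \<open>sum_measure_boxes_le\<close>. Boundedness of \<open>K\<close> serves the covering lemma, as
  the image of an open box may be unbounded.\<close>

lemma emeasure_bounded_subset_image_box_le:
  assumes "box a b \<subseteq> U" "bounded K" "K \<subseteq> F ` box a b"
  shows "emeasure lebesgue K \<le> emeasure lebesgue (box a b)"
proof -
  obtain c d :: "nat \<Rightarrow> real ^ 'n" where cd: "disjoint_family (\<lambda>n. box (c n) (d n))"
      "K \<subseteq> (\<Union>n. cbox (c n) (d n))" "(\<Union>n. cbox (c n) (d n)) \<subseteq> F ` box a b"
    by (rule bounded_cover_disjoint_boxes[OF assms(2) open_image[OF open_box assms(1)] assms(3)])
  have sub: "box (c n) (d n) \<subseteq> F ` box a b" for n using cd(3) box_subset_cbox by blast
  have "emeasure lebesgue K \<le> emeasure lebesgue (\<Union>n. cbox (c n) (d n))"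
    using cd(2) by (intro emeasure_mono) auto
  also have "\<dots> \<le> (\<Sum>n. emeasure lebesgue (box (c n) (d n)))"
    unfolding emeasure_lebesgue_cbox_eq_box[symmetric] by (intro emeasure_subadditive_countably) auto
  also have "\<dots> \<le> emeasure lebesgue (box a b)"
  proof (rule suminf_le_const)
    show "(\<Sum>n<N. emeasure lebesgue (box (c n) (d n))) \<le> emeasure lebesgue (box a b)" for N
      using sum_measure_boxes_le[OF assms(1) cd(1) sub, of N]
      unfolding emeasure_lebesgue_box by (simp add: sum_nonneg)
  qed simp
  finally show ?thesis .
qed

text \<open>The image of a closed box is compact, hence bounded, and lies in the image of each
  slightly larger open box in \<open>U\<close>; letting these shrink to the closed box gives the
  bound.\<close>

lemma emeasure_image_cbox_le:
  assumes "cbox a b \<subseteq> U"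
  shows "emeasure lebesgue (F ` cbox a b) \<le> emeasure lebesgue (cbox a b)"
proof (cases "cbox a b = {}")
  case False
  then have ab: "a $ i \<le> b $ i" for i by (simp add: interval_ne_empty_cart)
  obtain e where e: "e > 0" "(\<Union>x\<in>cbox a b. ball x e) \<subseteq> U"
    using compact_subset_open_imp_ball_epsilon_subset[OF compact_cbox open_U assms] by blast
  let ?B = "\<lambda>t. box (a - vec t) (b + vec t)"
  \<comment> \<open>The divisor \<open>CARD('n)\<close> comes from bounding the Euclidean norm by
    the sum of the coordinates. The point \<open>y\<close> below clamps each coordinate of
    \<open>x\<close> to the closed box.\<close>
  have B: "?B t \<subseteq> U" if t: "0 < t" "t < e / CARD('n)" for t
  proof
    fix x assume x: "x \<in> ?B t"
    define y :: "real ^ 'n" where "y = (\<chi> i. max (a $ i) (min (x $ i) (b $ i)))"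
    have "y \<in> cbox a b" using ab by (auto simp: y_def mem_box_cart)
    have "\<bar>(y - x) $ i\<bar> \<le> t" for i
    proof -
      have "a $ i - t < x $ i" "x $ i < b $ i + t" using x by (auto simp: mem_box_cart)
      then show ?thesis using ab[of i] t by (auto simp: y_def max_def min_def)
    qed
    then have "norm (y - x) \<le> (\<Sum>i\<in>(UNIV::'n set). t)"
      by (intro order_trans[OF norm_le_l1_cart] sum_mono)
    also have "\<dots> < e" using t by (simp add: field_simps)
    finally have "x \<in> ball y e" by (simp add: dist_norm)
    then show "x \<in> U" using e(2) \<open>y \<in> cbox a b\<close> by blast
  qed
  have mB: "emeasure lebesgue (?B t) = ennreal (\<Prod>i\<in>UNIV. b $ i - a $ i + 2 * t)" if "t \<ge> 0" for t
  proof -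
    have "a $ i - t \<le> b $ i + t" for i using ab[of i] that by linarith
    then have "cbox (a - vec t) (b + vec t) \<noteq> {}" by (simp add: interval_ne_empty_cart)
    then have "measure lborel (cbox (a - vec t) (b + vec t)) = (\<Prod>i\<in>UNIV. (b + vec t) $ i - (a - vec t) $ i)"
      by (rule content_cbox_cart)
    also have "\<dots> = (\<Prod>i\<in>UNIV. b $ i - a $ i + 2 * t)"
      by (intro prod.cong) auto
    finally show ?thesis
      by (simp add: emeasure_lebesgue_box measure_lborel_box_eq measure_lborel_cbox_eq)
  qed
  have "((\<lambda>t. ennreal (\<Prod>i\<in>UNIV. b $ i - a $ i + 2 * t)) \<longlongrightarrow> ennreal (\<Prod>i\<in>UNIV. b $ i - a $ i + 2 * 0)) (at_right 0)"
    by (intro tendsto_ennrealI tendsto_intros)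
  moreover have "\<forall>\<^sub>F t in at_right 0. emeasure lebesgue (F ` cbox a b)
      \<le> ennreal (\<Prod>i\<in>UNIV. b $ i - a $ i + 2 * t)"
  proof -
    have "\<forall>\<^sub>F t in at_right 0. 0 < t \<and> t < e / CARD('n)"
      using e by (auto simp: eventually_at_right_field intro!: exI[of _ "e / CARD('n)"])
    then show ?thesis
    proof eventually_elim
      case (elim t)
      have "compact (F ` cbox a b)"
        using assms cont_F by (intro compact_continuous_image) (auto intro: continuous_on_subset)
      moreover have "cbox a b \<subseteq> ?B t" using elim by (simp add: subset_interval_cart)
      ultimately have "emeasure lebesgue (F ` cbox a b) \<le> emeasure lebesgue (?B t)"
        using elim B by (intro emeasure_bounded_subset_image_box_le compact_imp_bounded image_mono) auto
      then show ?case using elim by (simp only: mB less_imp_le)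
    qed
  qed
  ultimately have "emeasure lebesgue (F ` cbox a b) \<le> ennreal (\<Prod>i\<in>UNIV. b $ i - a $ i + 2 * 0)"
    by (intro tendsto_lowerbound) auto
  then show ?thesis using mB[of 0] by (simp add: emeasure_lebesgue_cbox_eq_box)
qed simp

text \<open>An outer bound, because measurability of the image is not yet known: \<open>A\<close> is
  covered by boxes inside an open superset of nearly the same measure, and
  \<open>emeasure_image_cbox_le\<close> applies to each.\<close>

lemma image_bounded_outer:
  assumes "A \<in> sets lebesgue" "A \<subseteq> U" "bounded A" "e > 0"
  obtains B where "B \<in> sets lebesgue" "F ` A \<subseteq> B" "emeasure lebesgue B \<le> emeasure lebesgue A + ennreal e"
proof -
  obtain T where T: "open T" "A \<subseteq> T" "T - A \<in> lmeasurable" "emeasure lebesgue (T - A) < ennreal e"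
    using sets_lebesgue_outer_open[OF assms(1,4)] by blast
  have TU: "open (T \<inter> U)" "A \<subseteq> T \<inter> U" using T open_U assms(2) by auto
  obtain c d :: "nat \<Rightarrow> real ^ 'n" where cd: "disjoint_family (\<lambda>n. box (c n) (d n))"
      "A \<subseteq> (\<Union>n. cbox (c n) (d n))" "(\<Union>n. cbox (c n) (d n)) \<subseteq> T \<inter> U"
    by (rule bounded_cover_disjoint_boxes[OF assms(3) TU])
  have sub: "cbox (c n) (d n) \<subseteq> U" "cbox (c n) (d n) \<subseteq> T" for n using cd(3) by blast+
  let ?B = "\<Union>n. F ` cbox (c n) (d n)"
  have "compact (F ` cbox (c n) (d n))" for n
    using sub(1) cont_F by (intro compact_continuous_image) (auto intro: continuous_on_subset)
  then have meas: "F ` cbox (c n) (d n) \<in> sets lebesgue" for n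
    by (intro fmeasurableD lmeasurable_compact)
  show ?thesis
  proof
    show "?B \<in> sets lebesgue" using meas by auto
    show "F ` A \<subseteq> ?B" using cd(2) by blast
    have "emeasure lebesgue ?B \<le> (\<Sum>n. emeasure lebesgue (F ` cbox (c n) (d n)))"
      using meas by (intro emeasure_subadditive_countably) auto
    \<comment> \<open>Passing to the open boxes of equal volume gives disjointness, so that the sum
      is the measure of a union within \<open>T\<close>.\<close>
    also have "\<dots> \<le> (\<Sum>n. emeasure lebesgue (box (c n) (d n)))"
      using emeasure_image_cbox_le[OF sub(1)] unfolding emeasure_lebesgue_cbox_eq_box
      by (intro suminf_le) auto
    also have "\<dots> = emeasure lebesgue (\<Union>n. box (c n) (d n))"
      using cd(1) by (intro suminf_emeasure) auto
    also have "\<dots> \<le> emeasure lebesgue T"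
      using sub(2) box_subset_cbox T(1) by (intro emeasure_mono UN_least) (blast, simp)
    also have "T = A \<union> (T - A)" using T(2) by blast
    also have "emeasure lebesgue (A \<union> (T - A)) = emeasure lebesgue A + emeasure lebesgue (T - A)"
      using T(3) assms(1) by (intro plus_emeasure[symmetric]) auto
    also have "\<dots> \<le> emeasure lebesgue A + ennreal e"
      using T(4) by (intro add_left_mono) auto
    finally show "emeasure lebesgue ?B \<le> emeasure lebesgue A + ennreal e" .
  qed
qed

text \<open>Bounded null sets follow from \<open>image_bounded_outer\<close> with arbitrarily small
  error, the others by cutting along balls. This is Lusin's condition (N), which yields
  measurability of images.\<close>

lemma negligible_image:
  assumes "negligible N" "N \<subseteq> U"
  shows "negligible (F ` N)"
proof -
  have bdd: "negligible (F ` A)" if A: "negligible A" "A \<subseteq> U" "bounded A" for A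
    unfolding negligible_outer_le
  proof (intro allI impI)
    fix e :: real assume e: "e > 0"
    have "A \<in> sets lebesgue" using A(1) by (simp add: negligible_imp_sets)
    moreover have "emeasure lebesgue A = 0" using A(1) by (simp add: negligible_iff_emeasure0 calculation)
    ultimately obtain B where B: "B \<in> sets lebesgue" "F ` A \<subseteq> B" "emeasure lebesgue B \<le> ennreal e"
      using image_bounded_outer[OF _ A(2,3) e] by (metis add_0)
    then have "B \<in> lmeasurable" by (auto simp: fmeasurable_def top.not_eq_extremum intro: le_less_trans)
    moreover have "measure lebesgue B \<le> e"
      using B(3) e by (simp add: measure_def enn2real_leI)
    ultimately show "\<exists>T. F ` A \<subseteq> T \<and> T \<in> lmeasurable \<and> measure lebesgue T \<le> e" using B by blast
  qed
  have "F ` N = (\<Union>n. F ` (N \<inter> cball 0 (real n)))"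
    using real_arch_simple by (fastforce simp: image_iff)
  also have "negligible \<dots>"
    using assms by (intro negligible_Union_nat bdd) (auto intro: negligible_subset bounded_subset[OF bounded_cball])
  finally show ?thesis .
qed

text \<open>Up to a null set, \<open>A\<close> is a countable union of compact sets; continuity
  handles these and \<open>negligible_image\<close> the null set.\<close>

lemma image_lebesgue:
  assumes "A \<in> sets lebesgue" "A \<subseteq> U"
  shows "F ` A \<in> sets lebesgue"
  using sets_lebesgue_continuous_image[OF assms(1) cont_F negligible_image assms(2)] .

text \<open>Bounded pieces are settled by \<open>image_bounded_outer\<close>; as images are now
  known to be measurable, continuity from below along growing balls gives the rest.\<close>

lemma emeasure_image_le:
  assumes "A \<in> sets lebesgue" "A \<subseteq> U"
  shows "emeasure lebesgue (F ` A) \<le> emeasure lebesgue A"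
proof -
  let ?A = "\<lambda>n. A \<inter> cball 0 (real n)"
  have meas: "?A n \<in> sets lebesgue" for n using assms(1) by auto
  have bdd: "emeasure lebesgue (F ` ?A n) \<le> emeasure lebesgue (?A n)" for n
  proof (rule ennreal_le_epsilon)
    fix e :: real assume "e > 0"
    moreover have "bounded (?A n)" by (rule bounded_subset[OF bounded_cball]) auto
    ultimately obtain B where B: "B \<in> sets lebesgue" "F ` ?A n \<subseteq> B"
        "emeasure lebesgue B \<le> emeasure lebesgue (?A n) + ennreal e"
      using image_bounded_outer[OF meas] assms(2) by (metis le_infI1)
    have "emeasure lebesgue (F ` ?A n) \<le> emeasure lebesgue B" using B(2,1) by (rule emeasure_mono)
    also note B(3)
    finally show "emeasure lebesgue (F ` ?A n) \<le> emeasure lebesgue (?A n) + ennreal e" .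
  qed
  have "incseq (\<lambda>n. F ` ?A n)" by (force simp: incseq_def)
  moreover have "F ` A = (\<Union>n. F ` ?A n)"
    using real_arch_simple by (fastforce simp: image_iff)
  moreover have "range (\<lambda>n. F ` ?A n) \<subseteq> sets lebesgue"
    using image_lebesgue[OF meas] assms(2) by blast
  ultimately have "emeasure lebesgue (F ` A) = (SUP n. emeasure lebesgue (F ` ?A n))"
    by (metis SUP_emeasure_incseq)
  also have "\<dots> \<le> emeasure lebesgue A"
    using assms(1) by (intro SUP_least order_trans[OF bdd] emeasure_mono) auto
  finally show ?thesis .
qed

text \<open>A bijection between points of denominator \<open>k\<close> can be read in either
  direction, and invariance of domain makes the image open and the inverse continuous.\<close>

lemma inverse: "many_denominators (F ` U) (inv_into U F)"
proof
  show "open (F ` U)" by (rule open_image[OF open_U]) simp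
  show "continuous_on (F ` U) (inv_into U F)"
    using open_U cont_F inj_F by (intro continuous_on_inverse_open) auto
  show "inj_on (inv_into U F) (F ` U)" by (rule inj_on_inv_into) simp
  have "bij_betw (inv_into U F) {v \<in> F ` U \<inter> rational_points. den v = k} {u \<in> U \<inter> rational_points. den u = k}"
    if "bij_betw F {u \<in> U \<inter> rational_points. den u = k} {v \<in> F ` U \<inter> rational_points. den v = k}" for k
    using that inj_F by (intro bij_betw_inv_into_subset[where A' = "F ` U"]) (auto simp: bij_betw_def)
  moreover have "inv_into U F ` F ` U = U" using inj_F by simp
  ultimately show "preserves_many_denominators (F ` U) (inv_into U F)"
    using preserves unfolding preserves_many_denominators_def
    by (elim infinite_super[rotated]) auto
qed

lemma images_preserve: "images_preserve_lebesgue U F"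
  unfolding images_preserve_lebesgue_def
proof (intro allI impI conjI)
  fix A assume A: "A \<subseteq> U" "A \<in> sets lebesgue"
  show FA: "F ` A \<in> sets lebesgue" using A by (rule image_lebesgue[rotated])
  have "A = inv_into U F ` F ` A" using A(1) inj_F by simp
  also have "emeasure lebesgue \<dots> \<le> emeasure lebesgue (F ` A)"
    using many_denominators.emeasure_image_le[OF inverse FA] A(1) by blast
  finally show "emeasure lebesgue (F ` A) = emeasure lebesgue A"
    using emeasure_image_le[OF A(2,1)] by (rule antisym[rotated])
qed

end

theorem theorem1p1:
  fixes U :: "(real ^ 'n) set" and F :: "real ^ 'n \<Rightarrow> real ^ 'n"
  assumes "open U"
    and "continuous_on U F"
    and "inj_on F U"
    and "preserves_many_denominators U F"
  shows "preserves_lebesgue_measure U F"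
proof -
  interpret many_denominators U F using assms by unfold_locales
  show ?thesis
    unfolding preserves_lebesgue_measure_def
    using images_preserve many_denominators.images_preserve[OF inverse] by blast
qed

end
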